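(* Let $(\tilde\lambda,\tilde v)\in\mathbb{R}\times(\mathbb{R}^n\setminus\{0\})$ be an approximate eigenpair of the problem $A(v)v=\lambda v$, let $r=A(\tilde v)\tilde v-\tilde\lambda\tilde v$ be the associated residual, and let $w_1,\dots,w_m\ge0$ be weights with $\sum_{i=1}^m|f_i(\tilde v)|w_i>0$. Then the backward error is given by $$\eta(\tilde\lambda,\tilde v)=\frac{\|r\|}{\sum_{i=1}^m|f_i(\tilde v)|\,w_i\,\|\tilde v\|}.$$ This holds whether the perturbation matrices in the definition of $\eta$ are measured in the spectral norm or in the Frobenius norm.
   Context: Setting. Let $n,m$ be positive integers, and let $A:\mathbb{R}^n\to\mathbb{R}^{n\times n}$ be of the form $A(v)=\sum_{i=1}^m f_i(v)A_i$, where each $A_i\in\mathbb{R}^{n\times n}$ is symmetric, each $f_i:\mathbb{R}^n\to\mathbb{R}$ is scaling invariant, i.e. $f_i(\alpha x)=f_i(x)$ for all $x\in\mathbb{R}^n$ and $\alpha\in\mathbb{R}\setminus\{0\}$, and $A$ is continuously differentiable on $\mathbb{R}^n\setminus\{0\}$. The eigenvalue problem is to find $(\lambda,v)\in\mathbb{R}\times(\mathbb{R}^n\setminus\{0\})$ with $A(v)v=\lambda v$. An approximate eigenpair is an arbitrary pair $(\tilde\lambda,\tilde v)\in\mathbb{R}\times(\mathbb{R}^n\setminus\{0\})$. Definition. Given weights $w_i\ge0$, the backward error of $(\tilde\lambda,\tilde v)$ is $$\eta(\tilde\lambda,\tilde v)=\min\left\{|\varepsilon|:\ \Big(A(\tilde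 v)+\varepsilon\sum_{i=1}^m f_i(\tilde v)E_i\Big)\tilde v=\tilde\lambda\tilde v,\ \|E_i\|\le w_i,\ i=1,\dots,m\right\},$$ where the minimum is over $\varepsilon\in\mathbb{R}$ and $E_1,\dots,E_m\in\mathbb{R}^{n\times n}$, and the matrix norm is either the spectral norm or the Frobenius norm. For vectors, $\|\cdot\|$ is the Euclidean norm. In the formula of the claim, the denominator is $\big(\sum_{i=1}^m|f_i(\tilde v)|w_i\big)\|\tilde v\|$. *)

theory Defs
  imports "HOL-Analysis.Analysis"
begin

definition scaling_invariant :: "('a::real_vector \<Rightarrow> 'b) \<Rightarrow> bool" where
  "scaling_invariant f \<longleftrightarrow> (\<forall>x \<alpha>. \<alpha> \<noteq> 0 \<longrightarrow> f (\<alpha> *\<^sub>R x) = f x)"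

text \<open>
  The library's \<open>C1_differentiable_on\<close> only covers functions of one real variable. Here \<open>S\<close> is
  meant to be open, so that the derivative at each of its points is unique.
\<close>

definition continuously_differentiable_on ::
    "('a::real_normed_vector \<Rightarrow> 'b::real_normed_vector) \<Rightarrow> 'a set \<Rightarrow> bool" where
  "continuously_differentiable_on F S \<longleftrightarrow>
     (\<exists>F' :: 'a \<Rightarrow> 'a \<Rightarrow>\<^sub>L 'b.
        (\<forall>x\<in>S. (F has_derivative blinfun_apply (F' x)) (at x)) \<and> continuous_on S F')"

text \<open>The operator norm induced by the Euclidean vector norm.\<close>

definition spectral_norm :: "real ^ 'n ^ 'n \<Rightarrow> real" where
  "spectral_norm M = onorm (\<lambda>x. M *v x)"

definition frobenius_norm :: "real ^ 'n ^ 'n \<Rightarrow> real" where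
  "frobenius_norm M = sqrt (\<Sum>i\<in>UNIV. \<Sum>j\<in>UNIV. (M $ i $ j)\<^sup>2)"

definition coeff_matrix ::
    "nat \<Rightarrow> (nat \<Rightarrow> real ^ 'n \<Rightarrow> real) \<Rightarrow> (nat \<Rightarrow> real ^ 'n ^ 'n) \<Rightarrow> real ^ 'n \<Rightarrow> real ^ 'n ^ 'n" where
  "coeff_matrix m f C v = (\<Sum>i=1..m. f i v *\<^sub>R C i)"

definition backward_error_set ::
    "(real ^ 'n ^ 'n \<Rightarrow> real) \<Rightarrow> nat \<Rightarrow> (nat \<Rightarrow> real ^ 'n \<Rightarrow> real) \<Rightarrow> (nat \<Rightarrow> real ^ 'n ^ 'n) \<Rightarrow>
     (nat \<Rightarrow> real) \<Rightarrow> real \<Rightarrow> real ^ 'n \<Rightarrow> real set" where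
  "backward_error_set mnorm m f C w \<mu> v =
     {\<bar>\<epsilon>\<bar> | \<epsilon> E.
        (coeff_matrix m f C v + \<epsilon> *\<^sub>R (\<Sum>i=1..m. f i v *\<^sub>R E i)) *v v = \<mu> *\<^sub>R v \<and>
        (\<forall>i\<in>{1..m}. mnorm (E i) \<le> w i)}"

text \<open>
  The set may be infinite, so \<open>Min\<close> is not applicable; \<open>LEAST\<close> denotes the least element
  whenever one exists, and is unspecified otherwise.
\<close>

definition backward_error ::
    "(real ^ 'n ^ 'n \<Rightarrow> real) \<Rightarrow> nat \<Rightarrow> (nat \<Rightarrow> real ^ 'n \<Rightarrow> real) \<Rightarrow> (nat \<Rightarrow> real ^ 'n ^ 'n) \<Rightarrow>
     (nat \<Rightarrow> real) \<Rightarrow> real \<Rightarrow> real ^ 'n \<Rightarrow> real" where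
  "backward_error mnorm m f C w \<mu> v = (LEAST e. e \<in> backward_error_set mnorm m f C w \<mu> v)"

end

theory Submission
  imports Defs
begin

text \<open>
  Taking norms in \<open>\<epsilon> (\<Sum>i. f\<^sub>i(v) E\<^sub>i) v = - r\<close> gives the lower bound on \<open>\<bar>\<epsilon>\<bar>\<close>. It is attained by the
  rank-one matrices \<open>E\<^sub>i = - sgn(f\<^sub>i(v)) w\<^sub>i r v\<^sup>T / (\<parallel>r\<parallel> \<parallel>v\<parallel>)\<close>, whose spectral and Frobenius norms
  are both at most \<open>w\<^sub>i\<close>. Only two properties of the matrix norm enter: compatibility with the
  Euclidean norm and the bound \<open>\<parallel>a b\<^sup>T\<parallel> \<le> \<parallel>a\<parallel> \<parallel>b\<parallel>\<close>.
\<close>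

text \<open>The type class norm on nested vectors is the \<open>L2_set\<close> norm of the row
  norms, so the Frobenius norm can be handled row by row.\<close>

lemma frobenius_norm_eq_norm: "frobenius_norm M = norm M"
  unfolding frobenius_norm_def norm_vec_def L2_set_def by (simp add: sum_nonneg)

text \<open>Cauchy-Schwarz applied to each row, followed by monotonicity of the Euclidean norm in
  the components.\<close>

lemma norm_matrix_vector_mult_le_frobenius:
  "norm (M *v x) \<le> frobenius_norm M * norm x" for M :: "real ^ 'n ^ 'n"
proof -
  have "norm (M *v x) = L2_set (\<lambda>i. \<bar>M $ i \<bullet> x\<bar>) UNIV"
    by (simp add: norm_vec_def matrix_vector_mul_component)
  also have "\<dots> \<le> L2_set (\<lambda>i. norm (M $ i) * norm x) UNIV"
    by (intro L2_set_mono) (simp_all add: Cauchy_Schwarz_ineq2)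
  also have "\<dots> = frobenius_norm M * norm x"
    by (simp add: frobenius_norm_eq_norm norm_vec_def [of M] L2_set_left_distrib)
  finally show ?thesis .
qed

lemma norm_matrix_vector_mult_le_spectral: "norm (M *v x) \<le> spectral_norm M * norm x"
  unfolding spectral_norm_def by (intro onorm matrix_vector_mul_bounded_linear)

definition outer_product :: "real ^ 'n \<Rightarrow> real ^ 'n \<Rightarrow> real ^ 'n ^ 'n" where
  "outer_product a b = (\<chi> i. a $ i *\<^sub>R b)"

lemma outer_product_mult_vector: "outer_product a b *v x = (b \<bullet> x) *\<^sub>R a"
  by (simp add: outer_product_def vec_eq_iff matrix_vector_mul_component)

lemma frobenius_norm_outer_product: "frobenius_norm (outer_product a b) = norm a * norm b"
  by (simp add: frobenius_norm_eq_norm outer_product_def norm_vec_def [of "\<chi> i. a $ i *\<^sub>R b"]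
      norm_vec_def [of a] L2_set_left_distrib)

text \<open>The Frobenius norm dominates the spectral norm, and on rank-one matrices its value is
  exactly the bound claimed.\<close>

lemma spectral_norm_outer_product_le: "spectral_norm (outer_product a b) \<le> norm a * norm b"
  unfolding spectral_norm_def
proof (rule onorm_le)
  show "norm (outer_product a b *v x) \<le> norm a * norm b * norm x" for x
    using norm_matrix_vector_mult_le_frobenius [of "outer_product a b" x]
    by (simp add: frobenius_norm_outer_product)
qed

lemma sum_scaleR_matrix_vector_mult:
  "(\<Sum>i\<in>I. c i *\<^sub>R M i) *v x = (\<Sum>i\<in>I. c i *\<^sub>R (M i *v x))" for M :: "_ \<Rightarrow> real ^ 'n ^ 'm"
  by (induction I rule: infinite_finite_induct)
    (simp_all add: matrix_vector_mult_add_rdistrib scaleR_matrix_vector_assoc)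

text \<open>The perturbation has to cancel the whole residual, but within the weights it moves
  \<open>v\<close> by at most \<open>\<bar>\<epsilon>\<bar>\<close> times the denominator. Keeping
  \<open>mnorm\<close> abstract lets one argument serve both norms.\<close>

lemma backward_error_set_lower_bound:
  fixes C :: "nat \<Rightarrow> real ^ 'n ^ 'n"
  assumes compat: "\<And>M x. norm (M *v x) \<le> mnorm M * norm x"
    and S: "(\<Sum>i=1..m. \<bar>f i v\<bar> * w i) > 0"
    and v: "v \<noteq> 0"
    and e: "e \<in> backward_error_set mnorm m f C w \<mu> v"
  shows "norm (coeff_matrix m f C v *v v - \<mu> *\<^sub>R v) / ((\<Sum>i=1..m. \<bar>f i v\<bar> * w i) * norm v) \<le> e"
proof -
  let ?S = "\<Sum>i=1..m. \<bar>f i v\<bar> * w i"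
  obtain \<epsilon> E where e_eq: "e = \<bar>\<epsilon>\<bar>"
    and eq: "(coeff_matrix m f C v + \<epsilon> *\<^sub>R (\<Sum>i=1..m. f i v *\<^sub>R E i)) *v v = \<mu> *\<^sub>R v"
    and E: "\<And>i. i \<in> {1..m} \<Longrightarrow> mnorm (E i) \<le> w i"
    using e unfolding backward_error_set_def by blast
  have "\<mu> *\<^sub>R v = coeff_matrix m f C v *v v + \<epsilon> *\<^sub>R (\<Sum>i=1..m. f i v *\<^sub>R (E i *v v))"
    by (simp add: eq [symmetric] matrix_vector_mult_add_rdistrib sum_scaleR_matrix_vector_mult
        flip: scaleR_matrix_vector_assoc)
  then have "norm (coeff_matrix m f C v *v v - \<mu> *\<^sub>R v)
      = \<bar>\<epsilon>\<bar> * norm (\<Sum>i=1..m. f i v *\<^sub>R (E i *v v))"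
    by simp
  also have "norm (\<Sum>i=1..m. f i v *\<^sub>R (E i *v v)) \<le> (\<Sum>i=1..m. \<bar>f i v\<bar> * w i * norm v)"
  proof (rule sum_norm_le)
    fix i assume "i \<in> {1..m}"
    then have "norm (E i *v v) \<le> w i * norm v"
      using compat E by (meson mult_right_mono norm_ge_zero order_trans)
    then show "norm (f i v *\<^sub>R (E i *v v)) \<le> \<bar>f i v\<bar> * w i * norm v"
      by (simp add: mult.assoc mult_left_mono)
  qed
  finally have "norm (coeff_matrix m f C v *v v - \<mu> *\<^sub>R v) \<le> e * (?S * norm v)"
    by (simp add: e_eq mult_left_mono sum_distrib_right)
  then show ?thesis
    using S v by (simp add: pos_divide_le_eq)
qed

lemma backward_error_set_attained:
  fixes C :: "nat \<Rightarrow> real ^ 'n ^ 'n"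
  assumes outer: "\<And>a b. mnorm (outer_product a b) \<le> norm a * norm b"
    and w: "\<And>i. i \<in> {1..m} \<Longrightarrow> w i \<ge> 0"
    and S: "(\<Sum>i=1..m. \<bar>f i v\<bar> * w i) > 0"
    and v: "v \<noteq> 0"
  shows "norm (coeff_matrix m f C v *v v - \<mu> *\<^sub>R v) / ((\<Sum>i=1..m. \<bar>f i v\<bar> * w i) * norm v)
    \<in> backward_error_set mnorm m f C w \<mu> v"
proof -
  define r where "r = coeff_matrix m f C v *v v - \<mu> *\<^sub>R v"
  define S where "S = (\<Sum>i=1..m. \<bar>f i v\<bar> * w i)"
  define \<epsilon> where "\<epsilon> = norm r / (S * norm v)"
  \<comment> \<open>As \<open>sgn 0 = 0\<close>, this choice also covers \<open>r = 0\<close>.\<close>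
  define E where "E i = outer_product (- (sgn (f i v) * w i) *\<^sub>R sgn r) (sgn v)" for i
  have S_pos: "S > 0"
    using assms by (simp add: S_def)
  have sgn_v: "sgn v \<bullet> v = norm v"
    using v by (simp add: sgn_div_norm dot_square_norm power2_eq_square)
  \<comment> \<open>The factor \<open>sgn (f i v)\<close> turns \<open>f i v\<close> into its
    absolute value, so all terms are nonnegative multiples of \<open>- sgn r\<close> and nothing
    cancels in the sum.\<close>
  have "(\<Sum>i=1..m. f i v *\<^sub>R E i) *v v = - (\<Sum>i=1..m. (\<bar>f i v\<bar> * w i * norm v) *\<^sub>R sgn r)"
    by (simp add: sum_scaleR_matrix_vector_mult E_def outer_product_mult_vector sgn_v sum_negf
        abs_sgn mult_ac)
  also have "\<dots> = - (S * norm v) *\<^sub>R sgn r"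
    by (simp add: S_def sum_distrib_right flip: scaleR_left.sum)
  \<comment> \<open>If \<open>r \<noteq> 0\<close>, the factor \<open>S * norm v\<close> cancels
    against the denominator of \<open>\<epsilon>\<close> and \<open>norm r\<close> undoes the
    normalisation in \<open>sgn r\<close>. If \<open>r = 0\<close>, both sides vanish.\<close>
  finally have "\<epsilon> *\<^sub>R ((\<Sum>i=1..m. f i v *\<^sub>R E i) *v v) = - r"
    using S_pos v by (cases "r = 0") (simp_all add: \<epsilon>_def sgn_div_norm)
  then have "(coeff_matrix m f C v + \<epsilon> *\<^sub>R (\<Sum>i=1..m. f i v *\<^sub>R E i)) *v v = \<mu> *\<^sub>R v"
    by (simp add: matrix_vector_mult_add_rdistrib r_def flip: scaleR_matrix_vector_assoc)
  moreover have "mnorm (E i) \<le> w i" if "i \<in> {1..m}" for i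
  proof -
    have "mnorm (E i) \<le> norm (- (sgn (f i v) * w i) *\<^sub>R sgn r) * norm (sgn v)"
      unfolding E_def by (rule outer)
    \<comment> \<open>Every \<open>sgn\<close> factor, scalar or vector, has norm 0 or 1, so the
      product is either 0 or \<open>w i\<close>.\<close>
    also have "\<dots> \<le> w i"
      using w [OF that] by (simp add: norm_sgn abs_mult abs_sgn_eq)
    finally show ?thesis .
  qed
  moreover have "\<epsilon> = \<bar>\<epsilon>\<bar>"
    using S_pos by (simp add: \<epsilon>_def)
  ultimately show ?thesis
    unfolding backward_error_set_def r_def [symmetric] S_def [symmetric] \<epsilon>_def [symmetric] by blast
qed

theorem theorem4p2:
  fixes m :: nat
    and f :: "nat \<Rightarrow> real ^ 'n \<Rightarrow> real"
    and C :: "nat \<Rightarrow> real ^ 'n ^ 'n"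
    and w :: "nat \<Rightarrow> real"
    and \<mu> :: real
    and v r :: "real ^ 'n"
    and mnorm :: "real ^ 'n ^ 'n \<Rightarrow> real"
  assumes "m \<ge> 1"
    and "\<And>i. i \<in> {1..m} \<Longrightarrow> transpose (C i) = C i"
    and "\<And>i. i \<in> {1..m} \<Longrightarrow> scaling_invariant (f i)"
    and "continuously_differentiable_on (coeff_matrix m f C) (UNIV - {0})"
    and "v \<noteq> 0"
    and "r = coeff_matrix m f C v *v v - \<mu> *\<^sub>R v"
    and "\<And>i. i \<in> {1..m} \<Longrightarrow> w i \<ge> 0"
    and "(\<Sum>i=1..m. \<bar>f i v\<bar> * w i) > 0"
    and "mnorm = spectral_norm \<or> mnorm = frobenius_norm"
  shows "(\<exists>e \<in> backward_error_set mnorm m f C w \<mu> v.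
            \<forall>e' \<in> backward_error_set mnorm m f C w \<mu> v. e \<le> e')
       \<and> backward_error mnorm m f C w \<mu> v = norm r / ((\<Sum>i=1..m. \<bar>f i v\<bar> * w i) * norm v)"
proof -
  let ?B = "backward_error_set mnorm m f C w \<mu> v"
  let ?e = "norm r / ((\<Sum>i=1..m. \<bar>f i v\<bar> * w i) * norm v)"
  have compat: "norm (M *v x) \<le> mnorm M * norm x" for M x
    using assms(9) norm_matrix_vector_mult_le_spectral norm_matrix_vector_mult_le_frobenius by auto
  have outer: "mnorm (outer_product a b) \<le> norm a * norm b" for a b
    using assms(9) spectral_norm_outer_product_le frobenius_norm_outer_product
    by (metis order_refl)
  have mem: "?e \<in> ?B"
    unfolding assms(6) using outer assms(7,8,5) by (rule backward_error_set_attained)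
  have lower: "?e \<le> e" if "e \<in> ?B" for e
    unfolding assms(6) using compat assms(8,5) that by (rule backward_error_set_lower_bound)
  \<comment> \<open>Membership together with the lower bound makes \<open>?e\<close> the least
    element, so \<open>LEAST\<close> takes its intended value; the same two facts make
    \<open>?e\<close> the witness for the existence of the minimum.\<close>
  have "backward_error mnorm m f C w \<mu> v = ?e"
    unfolding backward_error_def using mem lower by (rule Least_equality)
  with mem lower show ?thesis
    by blast
qed

end
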